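(* For every formula $\phi$ of the language $\phi ::= p \mid \bot \mid \phi\to\phi \mid K_a\phi$ ($a\in A$): if $\phi$ is valid in the base-extension semantics for multi-agent $S5$, i.e. $\Vdash_{\mathscr{B},\mathfrak{R}_A}\phi$ for every base $\mathscr{B}$ and every family $\mathfrak{R}_A=(\mathfrak{R}_a)_{a\in A}$ of $S5$-modal relations, then $\phi$ is a theorem of multi-agent modal logic $S5$ (derivable in the Hilbert system described in the context).
   Context: Fix a countably infinite set of atomic formulae and a nonempty set $A$ of agents. Formulae: $\phi ::= p \mid \bot \mid \phi\to\phi \mid K_a\phi$ with $p$ atomic and $a\in A$; $\neg\phi$ abbreviates $\phi\to\bot$. Hilbert system for multi-agent $S5$: axioms, for all formulae $\phi,\psi,\chi$ and all $a\in A$: (1) $\phi\to(\psi\to\phi)$; (2) $(\phi\to(\psi\to\chi))\to((\phi\to\psi)\to(\phi\to\chi))$; (3) $(\neg\phi\to\neg\psi)\to(\psi\to\phi)$; (K) $K_a(\phi\to\psi)\to(K_a\phi\to K_a\psi)$; (T) $K_a\phi\to\phi$; (4) $K_a\phi\to K_aK_a\phi$; (5) $\neg K_a\phi\to K_a\neg K_a\phi$; rules (MP) from $\phi$ and $\phi\to\psi$ infer $\psi$; (NEC) from $\phi$ infer $K_a\phi$. A theorem is a formula derivable in this system. A base rule is written $p_1,\dots,p_n\Rightarrow p$, where $\{p_1,\dots,p_n\}$ is a finite (possibly empty) set of atoms and $p$ is an atom. A base is a countable set of base rules; $\Omega$ is the set of all bases. $\overline{\mathscr{B}}$ is the smallest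 set of atoms closed under the rules of $\mathscr{B}$. A base $\mathscr{B}$ is inconsistent iff every atom lies in $\overline{\mathscr{B}}$, and consistent otherwise. An $S5$-modal relation is a binary relation $\mathfrak{R}$ on $\Omega$ that is reflexive, transitive and Euclidean (if $\mathfrak{R}\mathscr{B}\mathscr{C}$ and $\mathfrak{R}\mathscr{B}\mathscr{D}$ then $\mathfrak{R}\mathscr{C}\mathscr{D}$) and satisfies, for all bases $\mathscr{B}$: (a) if $\mathscr{B}$ is inconsistent, there is an inconsistent $\mathscr{C}$ with $\mathfrak{R}\mathscr{B}\mathscr{C}$, and every $\mathscr{D}$ with $\mathfrak{R}\mathscr{B}\mathscr{D}$ is inconsistent; (b) if $\mathscr{B}$ is consistent, every $\mathscr{C}$ with $\mathfrak{R}\mathscr{B}\mathscr{C}$ is consistent; (c) for all $\mathscr{C}$, if $\mathfrak{R}\mathscr{B}\mathscr{C}$ then for every consistent $\mathscr{D}\supseteq\mathscr{B}$ there is $\mathscr{E}\supseteq\mathscr{C}$ with $\mathfrak{R}\mathscr{D}\mathscr{E}$; (d) for all consistent $\mathscr{C}$, if $\mathfrak{R}\mathscr{B}\mathscr{C}$ then for every $\mathscr{D}\subseteq\mathscr{B}$ there is $\mathscr{E}\subseteq\mathscr{C}$ with $\mathfrak{R}\mathscr{D}\mathscr{E}$. For a family $\mathfrak{R}_A=(\mathfrak{R}_a)_{a\in A}$ of $S5$-modal relations, validity at a base is defined inductively: $\Vdash_{\mathscr{B},\mathfrak{R}_A}p$ iff $p\in\overline{\mathscr{B}}$; $\Vdash_{\mathscr{B},\mathfrak{R}_A}\phi\to\psi$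 iff $\phi\Vdash_{\mathscr{B},\mathfrak{R}_A}\psi$; $\Vdash_{\mathscr{B},\mathfrak{R}_A}\bot$ iff $\Vdash_{\mathscr{B},\mathfrak{R}_A}p$ for every atom $p$; $\Vdash_{\mathscr{B},\mathfrak{R}_A}K_a\phi$ iff $\Vdash_{\mathscr{C},\mathfrak{R}_A}\phi$ for all $\mathscr{C}$ with $\mathfrak{R}_a\mathscr{B}\mathscr{C}$; and for a nonempty set $\Gamma$ of formulae, $\Gamma\Vdash_{\mathscr{B},\mathfrak{R}_A}\phi$ iff for every $\mathscr{C}\supseteq\mathscr{B}$, if $\Vdash_{\mathscr{C},\mathfrak{R}_A}\psi$ for all $\psi\in\Gamma$ then $\Vdash_{\mathscr{C},\mathfrak{R}_A}\phi$. *)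

theory Defs
  imports Main "HOL-Library.FSet" "HOL-Library.Countable_Set" "HOL-Library.Infinite_Typeclass"
begin

text \<open>
  Atoms are the elements of a type of class countable and infinite, agents the elements of
  an arbitrary type, which is nonempty like every type.
\<close>

datatype ('p, 'a) fm =
    Atom 'p
  | Falsum
  | Imp "('p, 'a) fm" "('p, 'a) fm"  (infixr "\<rightarrow>\<^sub>f" 55)
  | Know 'a "('p, 'a) fm"

abbreviation Neg :: "('p, 'a) fm \<Rightarrow> ('p, 'a) fm" where
  "Neg \<phi> \<equiv> \<phi> \<rightarrow>\<^sub>f Falsum"

inductive S5_theorem :: "('p, 'a) fm \<Rightarrow> bool" where
  Ax1: "S5_theorem (\<phi> \<rightarrow>\<^sub>f (\<psi> \<rightarrow>\<^sub>f \<phi>))"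
| Ax2: "S5_theorem ((\<phi> \<rightarrow>\<^sub>f (\<psi> \<rightarrow>\<^sub>f \<chi>)) \<rightarrow>\<^sub>f ((\<phi> \<rightarrow>\<^sub>f \<psi>) \<rightarrow>\<^sub>f (\<phi> \<rightarrow>\<^sub>f \<chi>)))"
| Ax3: "S5_theorem ((Neg \<phi> \<rightarrow>\<^sub>f Neg \<psi>) \<rightarrow>\<^sub>f (\<psi> \<rightarrow>\<^sub>f \<phi>))"
| AxK: "S5_theorem (Know a (\<phi> \<rightarrow>\<^sub>f \<psi>) \<rightarrow>\<^sub>f (Know a \<phi> \<rightarrow>\<^sub>f Know a \<psi>))"
| AxT: "S5_theorem (Know a \<phi> \<rightarrow>\<^sub>f \<phi>)"
| Ax4: "S5_theorem (Know a \<phi> \<rightarrow>\<^sub>f Know a (Know a \<phi>))"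
| Ax5: "S5_theorem (Neg (Know a \<phi>) \<rightarrow>\<^sub>f Know a (Neg (Know a \<phi>)))"
| MP: "S5_theorem \<phi> \<Longrightarrow> S5_theorem (\<phi> \<rightarrow>\<^sub>f \<psi>) \<Longrightarrow> S5_theorem \<psi>"
| NEC: "S5_theorem \<phi> \<Longrightarrow> S5_theorem (Know a \<phi>)"

text \<open>
  A pair (P, p) is the base rule with premise set P and conclusion p. A base is a countable set
  of base rules; since there are only countably many atoms, every set of base rules is countable
  (see the lemma below), so the type of bases carries no explicit countability condition and the
  set of all bases is the whole type.
\<close>

type_synonym 'p base_rule = "'p fset \<times> 'p"
type_synonym 'p base = "'p base_rule set"

lemma countable_base: "countable (B :: 'p::countable base)"
proof -
  have "range (fset :: 'p fset \<Rightarrow> 'p set) \<subseteq> Collect finite"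
    by auto
  then have "countable (range (fset :: 'p fset \<Rightarrow> 'p set))"
    using countable_Collect_finite countable_subset by blast
  then have "countable (UNIV :: 'p fset set)"
    by (rule countable_image_inj_on) (simp add: inj_on_def fset_inject)
  then have "countable ((UNIV :: 'p fset set) \<times> (UNIV :: 'p set))"
    by (intro countable_SIGMA) simp_all
  then show ?thesis
    by (rule countable_subset[rotated]) simp
qed

inductive_set base_closure :: "'p base \<Rightarrow> 'p set" for B :: "'p base" where
  apply_rule: "(P, p) \<in> B \<Longrightarrow> (\<And>q. q |\<in>| P \<Longrightarrow> q \<in> base_closure B) \<Longrightarrow> p \<in> base_closure B"

definition inconsistent :: "'p base \<Rightarrow> bool" where
  "inconsistent B \<longleftrightarrow> (\<forall>p. p \<in> base_closure B)"

abbreviation consistent :: "'p base \<Rightarrow> bool" where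
  "consistent B \<equiv> \<not> inconsistent B"

definition S5_modal_relation :: "('p base \<Rightarrow> 'p base \<Rightarrow> bool) \<Rightarrow> bool" where
  "S5_modal_relation R \<longleftrightarrow>
     reflp R \<and> transp R \<and> (\<forall>B C D. R B C \<longrightarrow> R B D \<longrightarrow> R C D) \<and>
     (\<forall>B. inconsistent B \<longrightarrow>
        (\<exists>C. inconsistent C \<and> R B C) \<and> (\<forall>D. R B D \<longrightarrow> inconsistent D)) \<and>
     (\<forall>B. consistent B \<longrightarrow> (\<forall>C. R B C \<longrightarrow> consistent C)) \<and>
     (\<forall>B C. R B C \<longrightarrow> (\<forall>D. consistent D \<longrightarrow> B \<subseteq> D \<longrightarrow> (\<exists>E. C \<subseteq> E \<and> R D E))) \<and>
     (\<forall>B C. consistent C \<longrightarrow> R B C \<longrightarrow> (\<forall>D. D \<subseteq> B \<longrightarrow> (\<exists>E. E \<subseteq> C \<and> R D E)))"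

text \<open>
  The clause for implication is the support judgement from the singleton set of the antecedent,
  unfolded: all extensions of the base validating the antecedent validate the consequent.
\<close>

primrec valid_at :: "('a \<Rightarrow> 'p base \<Rightarrow> 'p base \<Rightarrow> bool) \<Rightarrow> 'p base \<Rightarrow> ('p, 'a) fm \<Rightarrow> bool" where
  "valid_at R B (Atom p) \<longleftrightarrow> p \<in> base_closure B"
| "valid_at R B Falsum \<longleftrightarrow> (\<forall>p. p \<in> base_closure B)"
| "valid_at R B (\<phi> \<rightarrow>\<^sub>f \<psi>) \<longleftrightarrow> (\<forall>C. B \<subseteq> C \<longrightarrow> valid_at R C \<phi> \<longrightarrow> valid_at R C \<psi>)"
| "valid_at R B (Know a \<phi>) \<longleftrightarrow> (\<forall>C. R a B C \<longrightarrow> valid_at R C \<phi>)"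

definition bes_valid :: "('p, 'a) fm \<Rightarrow> bool" where
  "bes_valid \<phi> \<longleftrightarrow> (\<forall>B R. (\<forall>a. S5_modal_relation (R a)) \<longrightarrow> valid_at R B \<phi>)"

end

theory Submission
  imports Defs "HOL-Combinatorics.Permutations"
begin

text \<open>
  A non-theorem fails in a finite Kripke model (canonical worlds cut down to subformulae). Choose
  a valuation that agrees with this model on the atoms of the formula and in which every set of
  worlds is the truth set of infinitely many atoms. Then every permutation of the worlds is
  induced by a permutation of the atoms. Relating two bases for agent a whenever an atom
  permutation inducing a permutation of the worlds within the accessibility classes of a carries
  one to the other gives an orbit equivalence under order automorphisms of the set of bases; so
  the conditions on S5-modal relations hold automatically. The worlds embed as
  maximal consistent bases, whose proper extensions are all inconsistent, and there the
  base-extension semantics is the Kripke semantics.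
\<close>

section \<open>The finite model property of multi-agent S5\<close>

primrec subformulas :: "('p, 'a) fm \<Rightarrow> ('p, 'a) fm set" where
  "subformulas (Atom p) = {Atom p}"
| "subformulas Falsum = {Falsum}"
| "subformulas (\<phi> \<rightarrow>\<^sub>f \<psi>) = insert (\<phi> \<rightarrow>\<^sub>f \<psi>) (subformulas \<phi> \<union> subformulas \<psi>)"
| "subformulas (Know a \<phi>) = insert (Know a \<phi>) (subformulas \<phi>)"

lemma finite_subformulas: "finite (subformulas \<phi>)"
  by (induction \<phi>) auto

lemma subformulas_refl: "\<phi> \<in> subformulas \<phi>"
  by (cases \<phi>) auto

lemma subformulas_trans: "\<psi> \<in> subformulas \<phi> \<Longrightarrow> subformulas \<psi> \<subseteq> subformulas \<phi>"
  by (induction \<phi>) auto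

text \<open>The carrier \<open>W\<close> is explicit because canonical worlds are only some of the
  sets of formulae, while \<open>E\<close> can be an equivalence on the whole type.\<close>

primrec kripke_sat ::
  "'w set \<Rightarrow> ('a \<Rightarrow> 'w \<Rightarrow> 'w \<Rightarrow> bool) \<Rightarrow> ('w \<Rightarrow> 'p set) \<Rightarrow> 'w \<Rightarrow> ('p, 'a) fm \<Rightarrow> bool" where
  "kripke_sat W E V w (Atom p) \<longleftrightarrow> p \<in> V w"
| "kripke_sat W E V w Falsum \<longleftrightarrow> False"
| "kripke_sat W E V w (\<phi> \<rightarrow>\<^sub>f \<psi>) \<longleftrightarrow> (kripke_sat W E V w \<phi> \<longrightarrow> kripke_sat W E V w \<psi>)"
| "kripke_sat W E V w (Know a \<phi>) \<longleftrightarrow> (\<forall>v\<in>W. E a w v \<longrightarrow> kripke_sat W E V v \<phi>)"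

text \<open>Necessitation applies to theorems only, so that the deduction theorem holds.\<close>

inductive derives :: "('p, 'a) fm set \<Rightarrow> ('p, 'a) fm \<Rightarrow> bool" (infix "\<turnstile>\<^sub>f" 50)
  for \<Gamma> :: "('p, 'a) fm set" where
  hyp: "\<phi> \<in> \<Gamma> \<Longrightarrow> \<Gamma> \<turnstile>\<^sub>f \<phi>"
| S5: "S5_theorem \<phi> \<Longrightarrow> \<Gamma> \<turnstile>\<^sub>f \<phi>"
| mp: "\<Gamma> \<turnstile>\<^sub>f \<phi> \<Longrightarrow> \<Gamma> \<turnstile>\<^sub>f \<phi> \<rightarrow>\<^sub>f \<psi> \<Longrightarrow> \<Gamma> \<turnstile>\<^sub>f \<psi>"

lemma derives_mono:
  assumes "\<Gamma> \<turnstile>\<^sub>f \<phi>" "\<Gamma> \<subseteq> \<Delta>"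
  shows "\<Delta> \<turnstile>\<^sub>f \<phi>"
  using assms by induction (auto intro: derives.intros)

lemma derives_empty:
  assumes "{} \<turnstile>\<^sub>f \<phi>"
  shows "S5_theorem \<phi>"
  using assms by induction (auto intro: S5_theorem.MP)

text \<open>The combinator identity SKK = I.\<close>

lemma S5_theorem_refl: "S5_theorem (\<phi> \<rightarrow>\<^sub>f \<phi>)"
  by (rule MP[OF Ax1 MP[OF Ax1 Ax2]])

lemma deduction:
  assumes "insert \<chi> \<Gamma> \<turnstile>\<^sub>f \<psi>"
  shows "\<Gamma> \<turnstile>\<^sub>f \<chi> \<rightarrow>\<^sub>f \<psi>"
  using assms
proof induction
  case (hyp \<phi>)
  then show ?case
    by (metis S5_theorem_refl derives.hyp derives.S5 derives.mp Ax1 insertE)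
next
  case (S5 \<phi>)
  then show ?case by (metis derives.S5 derives.mp Ax1)
next
  case (mp \<phi> \<psi>)
  then show ?case by (metis derives.S5 derives.mp Ax2)
qed

text \<open>Contraposition against a provable formula: if \<open>Neg \<phi>\<close> is absurd, it
  implies \<open>Neg ?top\<close>, and \<open>Ax3\<close> turns this into
  \<open>?top \<rightarrow>\<^sub>f \<phi>\<close>.\<close>

lemma derives_by_contradiction:
  assumes "insert (Neg \<phi>) \<Gamma> \<turnstile>\<^sub>f Falsum"
  shows "\<Gamma> \<turnstile>\<^sub>f \<phi>"
proof -
  let ?top = "Neg Falsum :: ('a, 'b) fm"
  have "insert (Neg \<phi>) \<Gamma> \<turnstile>\<^sub>f Neg ?top"
    using assms by (metis derives.S5 derives.mp Ax1)
  then have "\<Gamma> \<turnstile>\<^sub>f ?top \<rightarrow>\<^sub>f \<phi>"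
    by (metis deduction derives.S5 derives.mp Ax3)
  then show ?thesis
    by (metis S5_theorem_refl derives.S5 derives.mp)
qed

lemma derives_ex_falso: "\<Gamma> \<turnstile>\<^sub>f Falsum \<Longrightarrow> \<Gamma> \<turnstile>\<^sub>f \<phi>"
  by (rule derives_by_contradiction) (erule derives_mono, blast)

text \<open>Decide the formulae of \<open>S\<close> one at a time: if neither \<open>s\<close> nor
  \<open>Neg s\<close> could be added, \<open>\<Gamma>\<close> would derive both
  \<open>Neg s\<close> and \<open>s\<close>. The induction generalises \<open>\<Gamma>\<close>
  because decided formulae move into it.\<close>

lemma lindenbaum_finite:
  assumes "finite S" "\<not> \<Gamma> \<turnstile>\<^sub>f Falsum"
  shows "\<exists>w\<subseteq>S. \<not> \<Gamma> \<union> (w \<union> Neg ` (S - w)) \<turnstile>\<^sub>f Falsum"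
  using assms
proof (induction S arbitrary: \<Gamma> rule: finite_induct)
  case empty
  then show ?case by simp
next
  case (insert s S)
  have "\<not> insert s \<Gamma> \<turnstile>\<^sub>f Falsum \<or> \<not> insert (Neg s) \<Gamma> \<turnstile>\<^sub>f Falsum"
    using insert.prems deduction derives_by_contradiction derives.mp by blast
  then show ?case
  proof
    assume "\<not> insert s \<Gamma> \<turnstile>\<^sub>f Falsum"
    then obtain w where w: "w \<subseteq> S" "\<not> insert s \<Gamma> \<union> (w \<union> Neg ` (S - w)) \<turnstile>\<^sub>f Falsum"
      using insert.IH by blast
    have "insert s \<Gamma> \<union> (w \<union> Neg ` (S - w))
        = \<Gamma> \<union> (insert s w \<union> Neg ` (insert s S - insert s w))"
      using insert.hyps by auto
    then show ?thesis
      using w by (metis insert_mono)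
  next
    assume "\<not> insert (Neg s) \<Gamma> \<turnstile>\<^sub>f Falsum"
    then obtain w where w: "w \<subseteq> S" "\<not> insert (Neg s) \<Gamma> \<union> (w \<union> Neg ` (S - w)) \<turnstile>\<^sub>f Falsum"
      using insert.IH by blast
    have "insert (Neg s) \<Gamma> \<union> (w \<union> Neg ` (S - w)) = \<Gamma> \<union> (w \<union> Neg ` (insert s S - w))"
      using insert.hyps w by auto
    then show ?thesis
      using w by (metis subset_insertI2)
  qed
qed

text \<open>Hypotheses that provably imply their own knowledge can be necessitated, and
  \<open>AxK\<close> carries this through modus ponens. Formulae \<open>Know a \<xi>\<close> and
  their negations qualify by \<open>Ax4\<close> and \<open>Ax5\<close>.\<close>

lemma derives_Know:
  assumes "\<Gamma> \<turnstile>\<^sub>f \<psi>" "\<And>\<chi>. \<chi> \<in> \<Gamma> \<Longrightarrow> S5_theorem (\<chi> \<rightarrow>\<^sub>f Know a \<chi>)"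
  shows "\<Gamma> \<turnstile>\<^sub>f Know a \<psi>"
  using assms(1)
proof induction
  case (hyp \<phi>)
  then show ?case by (metis assms(2) derives.hyp derives.S5 derives.mp)
next
  case (S5 \<phi>)
  then show ?case by (metis derives.S5 NEC)
next
  case (mp \<phi> \<psi>)
  then show ?case by (metis derives.S5 derives.mp AxK)
qed

section \<open>The finite canonical model\<close>

definition literals :: "('p, 'a) fm set \<Rightarrow> ('p, 'a) fm set \<Rightarrow> ('p, 'a) fm set" where
  "literals S w = w \<union> Neg ` (S - w)"

definition canonical_worlds :: "('p, 'a) fm set \<Rightarrow> ('p, 'a) fm set set" where
  "canonical_worlds S = {w. w \<subseteq> S \<and> \<not> literals S w \<turnstile>\<^sub>f Falsum}"

text \<open>Equality of knowledge is an equivalence outright. The usual condition, that whatever is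
  known at \<open>w\<close> holds at \<open>v\<close>, need not be symmetric on worlds cut down to a
  finite set.\<close>

definition canonical_rel :: "'a \<Rightarrow> ('p, 'a) fm set \<Rightarrow> ('p, 'a) fm set \<Rightarrow> bool" where
  "canonical_rel a w v \<longleftrightarrow> (\<forall>\<chi>. Know a \<chi> \<in> w \<longleftrightarrow> Know a \<chi> \<in> v)"

lemma canonical_worlds_closed:
  assumes "w \<in> canonical_worlds S" "\<psi> \<in> S"
  shows "\<psi> \<in> w \<longleftrightarrow> literals S w \<turnstile>\<^sub>f \<psi>"
proof
  show "literals S w \<turnstile>\<^sub>f \<psi>" if "\<psi> \<in> w"
    using that by (auto simp: literals_def intro: derives.hyp)
  show "\<psi> \<in> w" if der: "literals S w \<turnstile>\<^sub>f \<psi>"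
  proof (rule ccontr)
    assume "\<psi> \<notin> w"
    then have "literals S w \<turnstile>\<^sub>f Neg \<psi>"
      using assms(2) by (auto simp: literals_def intro: derives.hyp)
    then show False
      using der assms(1) derives.mp by (auto simp: canonical_worlds_def)
  qed
qed

text \<open>Since \<open>\<Gamma>\<close> may contain formulae outside \<open>S\<close>, joint
  consistency with the literals of \<open>w\<close> takes the place of inclusion in
  \<open>w\<close>.\<close>

lemma canonical_worlds_extend:
  assumes "finite S" "\<not> \<Gamma> \<turnstile>\<^sub>f Falsum"
  obtains w where "w \<in> canonical_worlds S" "\<not> \<Gamma> \<union> literals S w \<turnstile>\<^sub>f Falsum"
proof -
  obtain w where w: "w \<subseteq> S" "\<not> \<Gamma> \<union> literals S w \<turnstile>\<^sub>f Falsum"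
    using lindenbaum_finite[OF assms] by (auto simp: literals_def)
  then have "w \<in> canonical_worlds S"
    using derives_mono[of "literals S w" Falsum "\<Gamma> \<union> literals S w"]
    by (auto simp: canonical_worlds_def)
  then show thesis
    using w that by blast
qed

lemma derives_clash:
  "\<chi> \<in> \<Gamma> \<Longrightarrow> Neg \<chi> \<in> \<Gamma> \<Longrightarrow> \<Gamma> \<turnstile>\<^sub>f Falsum"
  by (metis derives.hyp derives.mp)

lemma canonical_successor:
  assumes S: "finite S" and w: "w \<in> canonical_worlds S"
    and K: "Know a \<psi> \<in> S" "Know a \<psi> \<notin> w" and "\<psi> \<in> S"
  shows "\<exists>v\<in>canonical_worlds S. canonical_rel a w v \<and> \<psi> \<notin> v"
proof -
  \<comment> \<open>All that \<open>w\<close> says about the knowledge of \<open>a\<close>, in both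
    polarities. If it refuted \<open>Neg \<psi>\<close>, it would derive \<open>\<psi>\<close> and
    hence, by introspection, \<open>Know a \<psi>\<close>.\<close>
  define \<Gamma> where "\<Gamma> = {\<chi> \<in> literals S w. \<exists>\<xi>. \<chi> = Know a \<xi> \<or> \<chi> = Neg (Know a \<xi>)}"
  have "\<not> insert (Neg \<psi>) \<Gamma> \<turnstile>\<^sub>f Falsum"
  proof
    assume "insert (Neg \<psi>) \<Gamma> \<turnstile>\<^sub>f Falsum"
    then have "\<Gamma> \<turnstile>\<^sub>f Know a \<psi>"
      by (rule derives_Know[OF derives_by_contradiction]) (auto simp: \<Gamma>_def intro: Ax4 Ax5)
    then have "literals S w \<turnstile>\<^sub>f Know a \<psi>"
      by (rule derives_mono) (auto simp: \<Gamma>_def)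
    then show False
      using canonical_worlds_closed[OF w K(1)] K(2) by blast
  qed
  then obtain v where v: "v \<in> canonical_worlds S"
    and cons: "\<not> insert (Neg \<psi>) \<Gamma> \<union> literals S v \<turnstile>\<^sub>f Falsum"
    using canonical_worlds_extend[OF S] by blast
  \<comment> \<open>A formula \<open>Know a \<chi>\<close> of \<open>S\<close> on which
    \<open>w\<close> and \<open>v\<close> disagreed would lie with its negation in this consistent
    set.\<close>
  have no_clash: "\<not> (\<chi> \<in> insert (Neg \<psi>) \<Gamma> \<union> literals S v \<and> Neg \<chi> \<in> insert (Neg \<psi>) \<Gamma> \<union> literals S v)"
    for \<chi>
    using cons derives_clash[of \<chi> "insert (Neg \<psi>) \<Gamma> \<union> literals S v"] by argo
  have "canonical_rel a w v"
    unfolding canonical_rel_def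
  proof (intro allI iffI)
    fix \<chi> assume "Know a \<chi> \<in> w"
    moreover from this have "Know a \<chi> \<in> S"
      using w by (auto simp: canonical_worlds_def)
    ultimately show "Know a \<chi> \<in> v"
      using no_clash[of "Know a \<chi>"] by (auto simp: \<Gamma>_def literals_def)
  next
    fix \<chi> assume "Know a \<chi> \<in> v"
    moreover from this have "Know a \<chi> \<in> S"
      using v by (auto simp: canonical_worlds_def)
    ultimately show "Know a \<chi> \<in> w"
      using no_clash[of "Know a \<chi>"] by (auto simp: \<Gamma>_def literals_def)
  qed
  moreover have "\<psi> \<notin> v"
    using no_clash[of \<psi>] by (auto simp: literals_def)
  ultimately show ?thesis
    using v by blast
qed

lemma canonical_truth:
  assumes S: "finite S" "\<And>\<psi>. \<psi> \<in> S \<Longrightarrow> subformulas \<psi> \<subseteq> S"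
    and "w \<in> canonical_worlds S" "\<psi> \<in> S"
  shows "kripke_sat (canonical_worlds S) canonical_rel (\<lambda>w. {p. Atom p \<in> w}) w \<psi> \<longleftrightarrow> \<psi> \<in> w"
  using assms(3,4)
proof (induction \<psi> arbitrary: w)
  case (Atom p)
  then show ?case by simp
next
  case Falsum
  then show ?case
    using canonical_worlds_closed[OF Falsum] by (simp add: canonical_worlds_def)
next
  case (Imp \<chi> \<psi>)
  have sub: "\<chi> \<in> S" "\<psi> \<in> S"
    using S(2)[OF Imp.prems(2)] subformulas_refl by auto
  note closed = canonical_worlds_closed[OF Imp.prems(1)]
  have "\<chi> \<rightarrow>\<^sub>f \<psi> \<in> w \<longleftrightarrow> (\<chi> \<in> w \<longrightarrow> \<psi> \<in> w)"
  proof
    assume "\<chi> \<rightarrow>\<^sub>f \<psi> \<in> w"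
    then show "\<chi> \<in> w \<longrightarrow> \<psi> \<in> w"
      using closed[OF Imp.prems(2)] closed[OF sub(1)] closed[OF sub(2)] derives.mp by blast
  next
    assume "\<chi> \<in> w \<longrightarrow> \<psi> \<in> w"
    then consider "\<psi> \<in> w" | "\<chi> \<notin> w" by blast
    then have "literals S w \<turnstile>\<^sub>f \<chi> \<rightarrow>\<^sub>f \<psi>"
    proof cases
      case 1
      then show ?thesis
        using closed[OF sub(2)] by (metis Ax1 derives.S5 derives.mp)
    next
      case 2
      then have "Neg \<chi> \<in> literals S w"
        using sub by (auto simp: literals_def)
      then have "insert \<chi> (literals S w) \<turnstile>\<^sub>f Falsum"
        by (intro derives_clash[of \<chi>]) auto
      then show ?thesis
        by (rule deduction[OF derives_ex_falso])
    qed
    then show "\<chi> \<rightarrow>\<^sub>f \<psi> \<in> w"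
      using closed[OF Imp.prems(2)] by blast
  qed
  then show ?case
    using Imp sub by simp
next
  case (Know a \<psi>)
  have sub: "\<psi> \<in> S"
    using S(2)[OF Know.prems(2)] subformulas_refl by auto
  have "(\<forall>v\<in>canonical_worlds S. canonical_rel a w v \<longrightarrow> \<psi> \<in> v) \<longleftrightarrow> Know a \<psi> \<in> w"
  proof
    assume "\<forall>v\<in>canonical_worlds S. canonical_rel a w v \<longrightarrow> \<psi> \<in> v"
    then show "Know a \<psi> \<in> w"
      using canonical_successor[OF S(1) Know.prems] sub by blast
  next
    assume K: "Know a \<psi> \<in> w"
    show "\<forall>v\<in>canonical_worlds S. canonical_rel a w v \<longrightarrow> \<psi> \<in> v"
    proof (intro ballI impI)
      fix v assume v: "v \<in> canonical_worlds S" "canonical_rel a w v"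
      \<comment> \<open>Related worlds share \<open>Know a \<psi>\<close>, so axiom T can be applied
        at \<open>v\<close> itself.\<close>
      then have "literals S v \<turnstile>\<^sub>f Know a \<psi>"
        using K canonical_worlds_closed[OF v(1) Know.prems(2)] by (simp add: canonical_rel_def)
      then show "\<psi> \<in> v"
        using canonical_worlds_closed[OF v(1) sub] by (metis AxT derives.S5 derives.mp)
    qed
  qed
  then show ?case
    using Know.IH sub by simp
qed

lemma equivp_canonical_rel: "equivp (canonical_rel a)"
  by (rule equivpI) (auto simp: canonical_rel_def intro: reflpI sympI transpI)

text \<open>Worlds are subsets of the finite set of subformulae of \<open>\<phi>\<close>. Finiteness
  of \<open>W\<close> later leaves only finitely many truth sets among which to distribute the
  atoms.\<close>

theorem S5_finite_model_property:
  fixes \<phi> :: "('p, 'a) fm"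
  assumes "\<not> S5_theorem \<phi>"
  shows "\<exists>(W :: ('p, 'a) fm set set) E V.
    finite W \<and> (\<forall>a. equivp (E a)) \<and> (\<exists>w\<in>W. \<not> kripke_sat W E V w \<phi>)"
proof -
  define S where "S = subformulas \<phi>"
  have S: "finite S" "\<And>\<psi>. \<psi> \<in> S \<Longrightarrow> subformulas \<psi> \<subseteq> S" "\<phi> \<in> S"
    using finite_subformulas subformulas_trans subformulas_refl unfolding S_def by blast+
  have "\<not> {Neg \<phi>} \<turnstile>\<^sub>f Falsum"
    using assms derives_by_contradiction derives_empty by blast
  then obtain w where w: "w \<in> canonical_worlds S" "\<not> {Neg \<phi>} \<union> literals S w \<turnstile>\<^sub>f Falsum"
    using canonical_worlds_extend[OF S(1)] by blast
  then have "\<phi> \<notin> w"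
    using derives_clash[of \<phi> "{Neg \<phi>} \<union> literals S w"] by (auto simp: literals_def)
  moreover have "finite (canonical_worlds S)"
    using S(1) by (auto simp: canonical_worlds_def)
  ultimately show ?thesis
    using canonical_truth[OF S(1,2) w(1) S(3)] w(1) equivp_canonical_rel by blast
qed

section \<open>Bases and atom permutations\<close>

definition map_base :: "('p \<Rightarrow> 'q) \<Rightarrow> 'p base \<Rightarrow> 'q base" where
  "map_base \<pi> B = (\<lambda>(P, p). (\<pi> |`| P, \<pi> p)) ` B"

lemma map_base_id: "map_base id B = B"
  by (auto simp: map_base_def image_iff)

lemma map_base_comp: "map_base \<pi> (map_base \<sigma> B) = map_base (\<pi> \<circ> \<sigma>) B"
  by (simp add: map_base_def image_image split_def fset.map_comp)

lemma map_base_mono: "B \<subseteq> C \<Longrightarrow> map_base \<pi> B \<subseteq> map_base \<pi> C"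
  by (auto simp: map_base_def)

lemma base_closure_mono:
  assumes "B \<subseteq> C"
  shows "base_closure B \<subseteq> base_closure C"
proof
  show "p \<in> base_closure C" if "p \<in> base_closure B" for p
    using that assms by induction (auto intro: base_closure.apply_rule)
qed

lemma inconsistent_mono: "inconsistent B \<Longrightarrow> B \<subseteq> C \<Longrightarrow> inconsistent C"
  using base_closure_mono unfolding inconsistent_def by blast

text \<open>Renaming the atoms throughout a derivation gives a derivation, for any map
  \<open>\<pi>\<close>.\<close>

lemma base_closure_map_base:
  assumes "p \<in> base_closure B"
  shows "\<pi> p \<in> base_closure (map_base \<pi> B)"
  using assms
proof induction
  case (apply_rule P p)
  have "(\<pi> |`| P, \<pi> p) \<in> map_base \<pi> B"
    using apply_rule by (force simp: map_base_def)
  then show ?case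
    by (rule base_closure.apply_rule) (use apply_rule in auto)
qed

lemma inconsistent_map_base: "surj \<pi> \<Longrightarrow> inconsistent B \<Longrightarrow> inconsistent (map_base \<pi> B)"
  unfolding inconsistent_def by (metis base_closure_map_base surjD)

lemma map_base_inv: "bij \<pi> \<Longrightarrow> map_base (inv \<pi>) (map_base \<pi> B) = B"
  by (simp add: map_base_comp map_base_id bij_is_inj)

text \<open>The extension and restriction conditions hold because a group element carrying B to C
  carries the extensions and the subsets of B to those of C.\<close>

lemma S5_modal_relation_orbit:
  fixes G :: "('p \<Rightarrow> 'p) set"
  assumes bij: "\<And>\<pi>. \<pi> \<in> G \<Longrightarrow> bij \<pi>"
    and id: "id \<in> G"
    and comp: "\<And>\<pi> \<sigma>. \<pi> \<in> G \<Longrightarrow> \<sigma> \<in> G \<Longrightarrow> \<pi> \<circ> \<sigma> \<in> G"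
    and inv: "\<And>\<pi>. \<pi> \<in> G \<Longrightarrow> inv \<pi> \<in> G"
  shows "S5_modal_relation (\<lambda>B C. \<exists>\<pi>\<in>G. C = map_base \<pi> B)" (is "S5_modal_relation ?R")
proof -
  have refl: "?R B B" for B
    using id map_base_id by metis
  have trans: "?R B D" if "?R B C" "?R C D" for B C D
    using that comp map_base_comp by metis
  have sym: "?R C B" if "?R B C" for B C
    using that inv bij map_base_inv by metis
  have incons: "inconsistent C" if "?R B C" "inconsistent B" for B C
    using that bij inconsistent_map_base bij_is_surj by metis
  have ext: "\<exists>E. C \<subseteq> E \<and> ?R D E" if "?R B C" "B \<subseteq> D" for B C D
    using that map_base_mono by metis
  have restr: "\<exists>E. E \<subseteq> C \<and> ?R D E" if "?R B C" "D \<subseteq> B" for B C D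
    using that map_base_mono by metis
  have "reflp ?R"
    using refl by (rule reflpI)
  moreover have "transp ?R"
    using trans by (rule transpI)
  moreover have "\<forall>B C D. ?R B C \<longrightarrow> ?R B D \<longrightarrow> ?R C D"
    using sym trans by metis
  moreover have "\<forall>B. inconsistent B \<longrightarrow>
      (\<exists>C. inconsistent C \<and> ?R B C) \<and> (\<forall>D. ?R B D \<longrightarrow> inconsistent D)"
    using refl incons by metis
  moreover have "\<forall>B. consistent B \<longrightarrow> (\<forall>C. ?R B C \<longrightarrow> consistent C)"
    using sym incons by metis
  moreover have "\<forall>B C. ?R B C \<longrightarrow> (\<forall>D. consistent D \<longrightarrow> B \<subseteq> D \<longrightarrow> (\<exists>E. C \<subseteq> E \<and> ?R D E))"
    using ext by metis
  moreover have "\<forall>B C. consistent C \<longrightarrow> ?R B C \<longrightarrow> (\<forall>D. D \<subseteq> B \<longrightarrow> (\<exists>E. E \<subseteq> C \<and> ?R D E))"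
    using restr by metis
  ultimately show ?thesis
    unfolding S5_modal_relation_def by (intro conjI)
qed

section \<open>Maximal bases\<close>

text \<open>The rules that are true under the valuation \<open>X\<close>, read as implications. This
  is the largest base with closure \<open>X\<close>.\<close>

definition full_base :: "'p set \<Rightarrow> 'p base" where
  "full_base X = {(P, p). fset P \<subseteq> X \<longrightarrow> p \<in> X}"

lemma base_closure_full_base: "base_closure (full_base X) = X"
proof
  show "base_closure (full_base X) \<subseteq> X"
  proof
    show "p \<in> X" if "p \<in> base_closure (full_base X)" for p
      using that by induction (auto simp: full_base_def)
  qed
  show "X \<subseteq> base_closure (full_base X)"
  proof
    show "p \<in> base_closure (full_base X)" if "p \<in> X" for p
      using that by (intro base_closure.apply_rule[of fempty p]) (auto simp: full_base_def)
  qed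
qed

text \<open>A rule outside the base has true premises and a false conclusion, and the base contains
  all rules leading from a false atom to any other atom.\<close>

lemma full_base_maximal:
  assumes "full_base X \<subset> C"
  shows "inconsistent C"
proof -
  obtain P p where Pp: "(P, p) \<in> C" "fset P \<subseteq> X" "p \<notin> X"
    using assms unfolding full_base_def by auto
  have "X \<subseteq> base_closure C"
    using base_closure_mono[of "full_base X" C] assms by (auto simp: base_closure_full_base)
  then have p: "p \<in> base_closure C"
    using Pp by (intro base_closure.apply_rule[of P p]) auto
  have "q \<in> base_closure C" for q
  proof (rule base_closure.apply_rule[of "{|p|}"])
    show "({|p|}, q) \<in> C"
      using assms Pp(3) by (auto simp: full_base_def)
  qed (use p in auto)
  then show ?thesis
    by (simp add: inconsistent_def)
qed

lemma map_base_full_base: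
  assumes "bij \<pi>"
  shows "map_base \<pi> (full_base X) = full_base (\<pi> ` X)"
proof
  show "map_base \<pi> (full_base X) \<subseteq> full_base (\<pi> ` X)"
    using assms by (auto simp: map_base_def full_base_def bij_is_inj inj_image_subset_iff)
  show "full_base (\<pi> ` X) \<subseteq> map_base \<pi> (full_base X)"
  proof
    fix r assume r: "r \<in> full_base (\<pi> ` X)"
    obtain P p where Pp: "r = (P, p)" by (cases r)
    have "(inv \<pi> |`| P, inv \<pi> p) \<in> full_base X"
    proof -
      have *: "inv \<pi> y \<in> X \<longleftrightarrow> y \<in> \<pi> ` X" for y
        using assms by (metis bij_inv_eq_iff image_iff)
      show ?thesis
        using r unfolding Pp full_base_def by (auto simp: * subset_iff)
    qed
    moreover have "r = (\<pi> |`| (inv \<pi> |`| P), \<pi> (inv \<pi> p))"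
      using assms by (simp add: Pp fset.map_comp bij_is_surj surj_iff[THEN iffD1] surj_f_inv_f)
    ultimately show "r \<in> map_base \<pi> (full_base X)"
      unfolding map_base_def by (metis (mono_tags, lifting) case_prod_conv image_iff)
  qed
qed

text \<open>Extensions and accessible bases of an inconsistent base are inconsistent again, so
  explosion passes from atoms through every connective.\<close>

lemma valid_at_inconsistent:
  assumes "\<And>a. S5_modal_relation (R a)" "inconsistent B"
  shows "valid_at R B \<phi>"
  using assms(2)
proof (induction \<phi> arbitrary: B)
  case (Imp \<phi> \<psi>)
  then show ?case
    using inconsistent_mono by auto
next
  case (Know a \<phi>)
  have "inconsistent C" if "R a B C" for C
    using assms(1)[of a] that Know.prems unfolding S5_modal_relation_def by metis
  then show ?case
    using Know.IH by simp
qed (auto simp: inconsistent_def)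

text \<open>Proper extensions are inconsistent and validate everything, so only the base itself
  matters and implication becomes classical.\<close>

lemma valid_at_full_base_Imp:
  assumes "\<And>a. S5_modal_relation (R a)"
  shows "valid_at R (full_base X) (\<phi> \<rightarrow>\<^sub>f \<psi>) \<longleftrightarrow>
    (valid_at R (full_base X) \<phi> \<longrightarrow> valid_at R (full_base X) \<psi>)"
proof -
  have "valid_at R C \<chi>" if "full_base X \<subset> C" for C \<chi>
    using assms full_base_maximal[OF that] by (rule valid_at_inconsistent)
  then show ?thesis
    by (auto simp: subset_iff_psubset_eq)
qed

section \<open>Realising finite Kripke models by bases\<close>

text \<open>The atoms outside \<open>A\<close> are numbered and dealt out to \<open>T\<close>
  cyclically, so that each element of \<open>T\<close> receives a whole residue class modulo
  \<open>card T\<close>.\<close>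

lemma infinite_fibres_extension:
  fixes f :: "'p::{countable, infinite} \<Rightarrow> 't"
  assumes A: "finite A" and T: "finite T" "T \<noteq> {}" and f: "f ` A \<subseteq> T"
  obtains g where "\<And>p. p \<in> A \<Longrightarrow> g p = f p" "range g \<subseteq> T" "\<And>t. t \<in> T \<Longrightarrow> infinite {p. g p = t}"
proof -
  have "infinite (UNIV - A :: 'p set)"
    using A infinite_UNIV by (simp add: Diff_infinite_finite)
  then obtain e :: "'p \<Rightarrow> nat" where e: "bij_betw e (UNIV - A) UNIV"
    using countableE_infinite[of "UNIV - A"] by auto
  obtain h :: "nat \<Rightarrow> 't" where h: "bij_betw h {0..<card T} T"
    using ex_bij_betw_nat_finite[OF T(1)] by blast
  have card: "card T > 0"
    using T by (simp add: card_gt_0_iff)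
  define g where "g p = (if p \<in> A then f p else h (e p mod card T))" for p
  show thesis
  proof (rule that)
    show "g p = f p" if "p \<in> A" for p
      using that by (simp add: g_def)
    have "h (n mod card T) \<in> T" for n
      using h card by (auto simp: bij_betw_def)
    then show "range g \<subseteq> T"
      using f by (auto simp: g_def)
    show "infinite {p. g p = t}" if t: "t \<in> T" for t
    proof -
      obtain i where i: "i < card T" "h i = t"
        using h t by (metis atLeastLessThan_iff bij_betw_def imageE)
      \<comment> \<open>The atom with number \<open>k * card T + i\<close>, where \<open>i\<close>
        is the index of \<open>t\<close>; these are infinitely many distinct atoms in the fibre of
        \<open>t\<close>.\<close>
      define c where "c k = inv_into (UNIV - A) e (k * card T + i)" for k
      have c: "c k \<in> UNIV - A" "e (c k) = k * card T + i" for k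
        using e unfolding c_def bij_betw_def
        by (metis UNIV_I inv_into_into, metis UNIV_I f_inv_into_f)
      have "inj c"
        by (rule injI) (metis c(2) add_right_cancel card mult_right_cancel less_numeral_extra(3))
      moreover have "range c \<subseteq> {p. g p = t}"
        using c i by (auto simp: g_def)
      ultimately show ?thesis
        using range_inj_infinite infinite_super by blast
    qed
  qed
qed

text \<open>All fibres are countably infinite, hence enumerated by the naturals. The lift sends the
  n-th atom over \<open>t\<close> to the n-th atom over \<open>s t\<close>, and an atom is
  determined by its fibre and its number.\<close>

lemma bij_lift_infinite_fibres:
  fixes f :: "'p::countable \<Rightarrow> 't"
  assumes f: "range f \<subseteq> T" "\<And>t. t \<in> T \<Longrightarrow> infinite {p. f p = t}" and s: "bij_betw s T T"
  obtains \<pi> where "bij \<pi>" "\<And>p. f (\<pi> p) = s (f p)"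
proof -
  define e where "e t = to_nat_on {p. f p = t}" for t
  have e: "bij_betw (e t) {p. f p = t} UNIV" if "t \<in> T" for t
    unfolding e_def using f(2)[OF that] by (intro to_nat_on_infinite) auto
  define \<pi> where "\<pi> p = inv_into {q. f q = s (f p)} (e (s (f p))) (e (f p) p)" for p
  have fT: "f p \<in> T" "s (f p) \<in> T" for p
    using f(1) s by (auto simp: bij_betw_def)
  have \<pi>: "f (\<pi> p) = s (f p)" "e (f (\<pi> p)) (\<pi> p) = e (f p) p" for p
  proof -
    have im: "e (f p) p \<in> e (s (f p)) ` {q. f q = s (f p)}"
      using e[OF fT(2)[of p]] by (simp add: bij_betw_def)
    show "f (\<pi> p) = s (f p)"
      using inv_into_into[OF im] by (simp add: \<pi>_def)
    then show "e (f (\<pi> p)) (\<pi> p) = e (f p) p"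
      using f_inv_into_f[OF im] by (simp add: \<pi>_def)
  qed
  have e_inj: "p = q" if "f p = f q" "e (f p) p = e (f q) q" for p q
    using e[OF fT(1)[of p]] that by (auto simp: bij_betw_def inj_on_def)
  have "inj \<pi>"
  proof (rule injI)
    fix p q assume eq: "\<pi> p = \<pi> q"
    then have "f p = f q"
      using \<pi>(1) s fT(1) by (metis bij_betw_def inj_onD)
    then show "p = q"
      using e_inj \<pi>(2) eq by metis
  qed
  moreover have "surj \<pi>"
    unfolding surj_def
  proof
    fix q
    obtain t where t: "t \<in> T" "s t = f q"
      using s fT(1)[of q] by (metis bij_betw_def imageE)
    \<comment> \<open>The preimage of \<open>q\<close> is the atom over \<open>t\<close> with the
      same number as \<open>q\<close>.\<close>
    obtain p where p: "f p = t" "e t p = e (f q) q"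
      using e[OF t(1)] by (metis (mono_tags, lifting) UNIV_I bij_betw_def imageE mem_Collect_eq)
    have "f (\<pi> p) = f q"
      using \<pi>(1) p(1) t(2) by simp
    moreover have "e (f (\<pi> p)) (\<pi> p) = e (f q) q"
      using \<pi>(2)[of p] p by simp
    ultimately have "\<pi> p = q"
      by (rule e_inj)
    then show "\<exists>p. q = \<pi> p"
      by blast
  qed
  ultimately show thesis
    using that \<pi>(1) by (simp add: bij_def)
qed

lemma finite_atoms: "finite {p. Atom p \<in> subformulas \<phi>}"
proof -
  have "finite (Atom -` subformulas \<phi>)"
    by (rule finite_vimageI[OF finite_subformulas]) (simp add: inj_def)
  then show ?thesis
    by (simp add: vimage_def)
qed

text \<open>Here T p is the truth set of the atom p, and an atom permutation induces g if it moves
  truth sets along g.\<close>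

definition world_group ::
  "'w set \<Rightarrow> ('w \<Rightarrow> 'w \<Rightarrow> bool) \<Rightarrow> ('p \<Rightarrow> 'w set) \<Rightarrow> ('p \<Rightarrow> 'p) set" where
  "world_group W E T =
    {\<pi>. bij \<pi> \<and> (\<exists>g. g permutes W \<and> (\<forall>w\<in>W. E w (g w)) \<and> (\<forall>p. T (\<pi> p) = g ` T p))}"

text \<open>The group laws mirror those of \<open>E\<close>: reflexivity gives the identity,
  transitivity composition and symmetry inverses.\<close>

lemma S5_modal_relation_world_group:
  assumes "equivp E"
  shows "S5_modal_relation (\<lambda>B C. \<exists>\<pi>\<in>world_group W E T. C = map_base \<pi> B)"
proof (rule S5_modal_relation_orbit)
  show "bij \<pi>" if "\<pi> \<in> world_group W E T" for \<pi>
    using that by (simp add: world_group_def)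
  have "id permutes W"
    by (rule permutes_id)
  then show "id \<in> world_group W E T"
    using equivp_reflp[OF assms] by (auto simp: world_group_def intro!: exI[of _ id])
  show "\<pi> \<circ> \<sigma> \<in> world_group W E T"
    if "\<pi> \<in> world_group W E T" "\<sigma> \<in> world_group W E T" for \<pi> \<sigma>
  proof -
    obtain g where g: "bij \<pi>" "g permutes W" "\<forall>w\<in>W. E w (g w)" "\<forall>p. T (\<pi> p) = g ` T p"
      using \<open>\<pi> \<in> _\<close> by (auto simp: world_group_def)
    obtain h where h: "bij \<sigma>" "h permutes W" "\<forall>w\<in>W. E w (h w)" "\<forall>p. T (\<sigma> p) = h ` T p"
      using \<open>\<sigma> \<in> _\<close> by (auto simp: world_group_def)
    have "\<forall>w\<in>W. E w ((g \<circ> h) w)"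
      using g(3) h(3) permutes_in_image[OF h(2)] equivp_transp[OF assms] by (metis comp_apply)
    moreover have "\<forall>p. T ((\<pi> \<circ> \<sigma>) p) = (g \<circ> h) ` T p"
      using g(4) h(4) by (simp add: image_comp)
    ultimately show ?thesis
      using permutes_compose[OF h(2) g(2)] bij_comp[OF h(1) g(1)]
      by (auto simp: world_group_def)
  qed
  show "inv \<pi> \<in> world_group W E T" if "\<pi> \<in> world_group W E T" for \<pi>
  proof -
    obtain g where g: "bij \<pi>" "g permutes W" "\<forall>w\<in>W. E w (g w)" "\<forall>p. T (\<pi> p) = g ` T p"
      using \<open>\<pi> \<in> _\<close> by (auto simp: world_group_def)
    have "\<forall>w\<in>W. E w (inv g w)"
      using g(2,3) permutes_in_image[OF permutes_inv[OF g(2)]] permutes_inverses[OF g(2)]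
        equivp_symp[OF assms] by metis
    moreover have "T (inv \<pi> p) = inv g ` T p" for p
    proof -
      have "T p = g ` T (inv \<pi> p)"
        using g(1,4) by (metis bij_is_surj surj_f_inv_f)
      then show ?thesis
        using permutes_inj[OF g(2)] by (simp add: image_comp)
    qed
    ultimately show ?thesis
      using permutes_inv[OF g(2)] bij_imp_bij_inv[OF g(1)] by (auto simp: world_group_def)
  qed
qed

text \<open>The atoms true at a world form its valuation. The orbit of the corresponding base
  consists of the bases of the worlds in the same class, so accessibility is reproduced
  exactly.\<close>

lemma world_group_orbit:
  fixes T :: "'p::countable \<Rightarrow> 'w set"
  assumes E: "equivp E"
    and T: "range T \<subseteq> Pow W" "\<And>t. t \<subseteq> W \<Longrightarrow> infinite {p. T p = t}" and w: "w \<in> W"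
  shows "(\<exists>\<pi>\<in>world_group W E T. C = map_base \<pi> (full_base {p. w \<in> T p})) \<longleftrightarrow>
    (\<exists>v\<in>W. E w v \<and> C = full_base {p. v \<in> T p})"
proof -
  \<comment> \<open>Since \<open>p\<close> holds at \<open>w\<close> iff \<open>\<pi> p\<close>
    holds at \<open>g w\<close>, the permutation carries the valuation of \<open>w\<close> onto that
    of \<open>g w\<close>.\<close>
  have move: "map_base \<pi> (full_base {p. w \<in> T p}) = full_base {p. g w \<in> T p}"
    if "bij \<pi>" "g permutes W" "\<forall>p. T (\<pi> p) = g ` T p" for \<pi> g
  proof -
    have "g w \<in> T (\<pi> p) \<longleftrightarrow> w \<in> T p" for p
      using that(3) permutes_inj[OF that(2)] by (simp add: inj_image_mem_iff)
    then have "\<pi> ` {p. w \<in> T p} = {p. g w \<in> T p}"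
      using bij_is_surj[OF that(1)] by (auto simp: image_iff) (metis surjD)
    then show ?thesis
      using map_base_full_base[OF that(1)] by simp
  qed
  show ?thesis
  proof
    assume "\<exists>\<pi>\<in>world_group W E T. C = map_base \<pi> (full_base {p. w \<in> T p})"
    then obtain \<pi> g where "bij \<pi>" "g permutes W" "\<forall>w\<in>W. E w (g w)" "\<forall>p. T (\<pi> p) = g ` T p"
      and C: "C = map_base \<pi> (full_base {p. w \<in> T p})"
      by (auto simp: world_group_def)
    then show "\<exists>v\<in>W. E w v \<and> C = full_base {p. v \<in> T p}"
      using move w permutes_in_image by metis
  next
    assume "\<exists>v\<in>W. E w v \<and> C = full_base {p. v \<in> T p}"
    then obtain v where v: "v \<in> W" "E w v" "C = full_base {p. v \<in> T p}"
      by blast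
    \<comment> \<open>Swapping two related worlds and fixing all others keeps every world in its
      class.\<close>
    define g where "g = transpose w v"
    have g: "g permutes W" "g w = v"
      using w v(1) by (auto simp: g_def intro: permutes_swap_id)
    have gE: "\<forall>u\<in>W. E u (g u)"
      using v(2) equivp_reflp[OF E] equivp_symp[OF E] by (auto simp: g_def transpose_def)
    \<comment> \<open>Truth sets are sets of worlds, so it is the action of \<open>g\<close> on
      \<open>Pow W\<close> that is lifted to atoms.\<close>
    have "bij_betw ((`) g) (Pow W) (Pow W)"
      using permutes_imp_bij[OF g(1)] by (rule bij_betw_Pow)
    then obtain \<pi> where \<pi>: "bij \<pi>" "\<And>p. T (\<pi> p) = g ` T p"
      using bij_lift_infinite_fibres[of T "Pow W" "(`) g"] T by auto
    then have "\<pi> \<in> world_group W E T"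
      using g(1) gE by (auto simp: world_group_def)
    then show "\<exists>\<pi>\<in>world_group W E T. C = map_base \<pi> (full_base {p. w \<in> T p})"
      using move[of \<pi> g] \<pi> g v(3) by auto
  qed
qed

text \<open>Only the atoms of \<open>\<phi>\<close> must keep their truth sets from
  \<open>V\<close>; the remaining ones supply the infinite fibres. Hence the induction is restricted
  to subformulae of \<open>\<phi>\<close>.\<close>

theorem kripke_model_realised:
  fixes \<phi> :: "('p::{countable, infinite}, 'a) fm"
  assumes W: "finite W" and E: "\<forall>a. equivp (E a)"
  shows "\<exists>R base_of. (\<forall>a. S5_modal_relation (R a)) \<and>
    (\<forall>w\<in>W. valid_at R (base_of w) \<phi> \<longleftrightarrow> kripke_sat W E V w \<phi>)"
proof -
  obtain T where T: "\<And>p. Atom p \<in> subformulas \<phi> \<Longrightarrow> T p = {w \<in> W. p \<in> V w}"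
    and T_range: "range T \<subseteq> Pow W" and T_inf: "\<And>t. t \<in> Pow W \<Longrightarrow> infinite {p. T p = t}"
    using infinite_fibres_extension[OF finite_atoms[of \<phi>], of "Pow W" "\<lambda>p. {w \<in> W. p \<in> V w}"] W
    by auto
  define R where "R a B C \<longleftrightarrow> (\<exists>\<pi>\<in>world_group W (E a) T. C = map_base \<pi> B)" for a B C
  have R: "S5_modal_relation (R a)" for a
    unfolding R_def using E[rule_format] by (rule S5_modal_relation_world_group)
  \<comment> \<open>From the base of a world only bases of worlds are accessible, so both clauses
    for \<open>Know\<close> quantify over the same worlds.\<close>
  have R_worlds: "R a (full_base {p. w \<in> T p}) C \<longleftrightarrow> (\<exists>v\<in>W. E a w v \<and> C = full_base {p. v \<in> T p})"
    if "w \<in> W" for a w C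
    unfolding R_def using world_group_orbit[OF E[rule_format] T_range _ that] T_inf by blast
  have "valid_at R (full_base {p. w \<in> T p}) \<psi> \<longleftrightarrow> kripke_sat W E V w \<psi>"
    if "w \<in> W" "subformulas \<psi> \<subseteq> subformulas \<phi>" for w \<psi>
    using that
  proof (induction \<psi> arbitrary: w)
    case (Atom p)
    then show ?case
      using T by (simp add: base_closure_full_base)
  next
    case Falsum
    \<comment> \<open>An atom with empty truth set is underivable in every base of a world, so these
      bases are consistent.\<close>
    have "{p. T p = {}} \<noteq> {}"
      using T_inf[of "{}"] by (metis Pow_bottom finite.emptyI)
    then show ?case
      by (auto simp: base_closure_full_base)
  next
    case (Imp \<psi> \<chi>)
    then show ?case
      using valid_at_full_base_Imp[of R, OF R] by simp
  next
    case (Know a \<psi>)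
    then show ?case
      using R_worlds by auto
  qed
  with R show ?thesis
    by (intro exI[of _ R] exI[of _ "\<lambda>w. full_base {p. w \<in> T p}"]) simp
qed

theorem theorem5p4:
  fixes \<phi> :: "('p::{countable, infinite}, 'a) fm"
  assumes "bes_valid \<phi>"
  shows "S5_theorem \<phi>"
proof (rule ccontr)
  assume "\<not> S5_theorem \<phi>"
  from S5_finite_model_property[OF this] obtain W :: "('p, 'a) fm set set" and E V w
    where W: "finite W" "\<forall>a. equivp (E a)" "w \<in> W" and not_sat: "\<not> kripke_sat W E V w \<phi>"
    by blast
  from kripke_model_realised[OF W(1,2), where \<phi> = \<phi> and V = V] obtain R base_of
    where "\<forall>a. S5_modal_relation (R a)"
      "\<forall>w\<in>W. valid_at R (base_of w) \<phi> \<longleftrightarrow> kripke_sat W E V w \<phi>"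
    by blast
  then show False
    using assms not_sat W(3) by (auto simp: bes_valid_def)
qed

end
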